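(* Let $(G,\circ,\dotplus,[\![\cdot]\!])$ be an entropy-driven hemi-group with comparable elements (see context), let $G_s$ be its set of deterministic systems, $s\in\{-1,+1\}$ its sign, and $\Xi$ its set of admissible parameters. Let $a\in\Xi\setminus\{0\}$ and let $\langle\cdot,\cdot\rangle_*$ denote any one of $\langle\cdot,\cdot\rangle$, $\langle\cdot,\cdot\rangle_2$ (the canonical hemi-scalar products) or $\langle\cdot,\cdot\rangle_{\rm assoc}$ (the associated hemi-scalar product). Then for all $\xi,\eta,\nu\in G$ and $\varepsilon\in G_s$: 1. $\langle\xi,\eta\rangle_*=\langle\eta,\xi\rangle_*$ if and only if $[\![\xi\dotplus\eta]\!]=[\![\eta\dotplus\xi]\!]$; 2. $\langle\xi,\xi\rangle_*\ge 0$; 3. $\langle\xi\dotplus\eta,\nu\rangle_*=\langle\xi,\eta\dotplus\nu\rangle_*-\langle\xi,\eta\rangle_*+\langle\eta,\nu\rangle_*$; 4. $\langle\xi,\varepsilon\rangle_*=0$; 5. $s\,\langle\xi,\eta\rangle_{\rm assoc}\ \ge\ -\dfrac{[\![\xi\circ\eta]\!]}{\sup\Xi}$; 6. $s\,\langle\xi,\eta\rangle_{\rm assoc}\ \le\ -\dfrac{[\![\xi\circ\eta]\!]}{\inf\Xi}$, if $\inf\Xi\neq 0$; 7. $s\,\langle\xi,\eta\rangle_{\rm assoc}\ \ge\ \dfrac{[\![\xi\dotplus\eta]\!]}{1-\sup\Xi}$, if $\sup\Xi\neq 1$; 8. $s\,\langle\xi,\eta\rangle_{\rm assoc}\ \le\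 \dfrac{[\![\xi\dotplus\eta]\!]}{1-\inf\Xi}$; 9. $\rho_a(\xi,\eta)=\rho_a(\eta,\xi)$ if and only if $[\![\xi\dotplus\eta]\!]=[\![\eta\dotplus\xi]\!]$; 10. $\rho_a(\xi,\varepsilon)=[\![\xi]\!]$. Here $x/(\pm\infty):=0$ for finite $x$.
   Context: Entropy: for a topological space $G$, a map $[\![\cdot]\!]:G\to[0,\infty]$ is an entropy if $G_0:=\{\xi\in G:[\![\xi]\!]=0\}$ is measurable, nonempty and not all of $G$, and $[\![\cdot]\!]$ is continuous on $G\setminus G_0$. Entropy-driven hemi-group: let $G^*$ be a topological space, $[\![\cdot]\!]:G^*\to[0,\infty]$ a map, $G\subset G^*$ a measurable subset and $\circ:G\times G^*\to G^*$ a measurable operator. If $[\![\cdot]\!]$ restricted to $G$ is an entropy and $[\![\xi\circ\nu]\!]=[\![\xi]\!]+[\![\nu]\!]$ for all $\xi\in G$, $\nu\in G^*$, then $(G,\circ,[\![\cdot]\!])$ is an entropy-driven hemi-group. Comparable elements: $(G,\circ,\dotplus,[\![\cdot]\!])$ has comparable elements if $(G,\circ,[\![\cdot]\!])$ is an entropy-driven hemi-group with $[\![\xi]\!]<\infty$ for all $\xi\in G$, and $\dotplus$ is a binary operation on $G$ such that (i) there is a nonempty subset $G_s\subset G_0$ (the deterministic systems) with $[\![\xi\dotplus\eta]\!]=[\![\eta\dotplus\xi]\!]=[\![\xi]\!]$ for all $\xi\in G$, $\eta\in G_s$; and (ii) the function $\xi\mapsto[\![\xi\dotplus\xi]\!]-2[\![\xi]\!]$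 on $G$ does not change sign. The sign in (ii) is denoted $s\in\{-1,+1\}$, so $s([\![\xi\dotplus\xi]\!]-2[\![\xi]\!])\ge0$ for all $\xi\in G$ (if the function vanishes identically, $s$ may be chosen freely). For $a\in\mathbb R$: $\rho_a(\xi,\nu)=a[\![\xi\dotplus\nu]\!]+(1-a)[\![\xi\circ\nu]\!]$, $\xi,\nu\in G$. $\Xi=\{a\in\mathbb R:\rho_a(\xi,\nu)\ge0\ \forall\xi,\nu\in G\}$ (an interval containing $[0,1]$, possibly unbounded). Associated hemi-scalar product: $\langle\xi,\eta\rangle_{\rm assoc}=s([\![\xi\dotplus\eta]\!]-[\![\xi\circ\eta]\!])$. Let $M_G=\sup\frac{[\![\xi\dotplus\nu]\!]}{[\![\xi\circ\nu]\!]}$ and $m_G=\inf\frac{[\![\xi\dotplus\nu]\!]}{[\![\xi\circ\nu]\!]}$ over all $\xi,\nu\in G$ with $[\![\xi\circ\nu]\!]>0$; $a_{-1}=1/(1-m_G)$, $a_{+1}=1/(1-M_G)$; $a_s$ is the one of these selected by the sign $s$. The canonical hemi-scalar products, which are defined when $a_s$ is finite, are $\langle\cdot,\cdot\rangle=|a_s|\,\langle\cdot,\cdot\rangle_{\rm assoc}=-a_s([\![\cdot\dotplus\cdot]\!]-[\![\cdot\circ\cdot]\!])$ and $\langle\cdot,\cdot\rangle_2=\langle\cdot,\cdot\rangle/2$.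
   Formalization: Item 3 is stated for triples with (ξ∔η)∔ν = ξ∔(η∔ν), since it fails for non-associative ∔; item 1 for the two canonical products assumes a_s ≠ 0, since they vanish identically when a_s = 0 (s = 1, M_G = ∞). *)

theory Defs
  imports "HOL-Analysis.Analysis"
begin

text \<open>
  The ambient space \<open>G*\<close> is a type of class \<^class>\<open>topological_space\<close>; \<open>G\<close> is a subset of it
  with the subspace topology, and "measurable" refers to Borel sets.  The map \<open>ent\<close> renders the
  double brackets.  Once \<open>ent\<close> is known to be finite on \<open>G\<close>, arithmetic with signs is done in the
  reals, through \<^const>\<open>enn2real\<close>.
\<close>

definition zero_set :: "'a set \<Rightarrow> ('a \<Rightarrow> ennreal) \<Rightarrow> 'a set" where
  "zero_set G ent = {\<xi> \<in> G. ent \<xi> = 0}"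

definition entropy_on :: "'a::topological_space set \<Rightarrow> ('a \<Rightarrow> ennreal) \<Rightarrow> bool" where
  "entropy_on G ent \<longleftrightarrow>
     zero_set G ent \<in> sets (restrict_space borel G) \<and>
     zero_set G ent \<noteq> {} \<and> zero_set G ent \<noteq> G \<and>
     continuous_on (G - zero_set G ent) ent"

text \<open>
  Measurability of the operator is taken with respect to the Borel sets of the product topology
  on \<open>G \<times> G*\<close>.  These contain the product sigma-algebra, so this hypothesis is implied by
  measurability with respect to the latter.
\<close>

definition entropy_driven_hemigroup ::
  "'a::topological_space set \<Rightarrow> ('a \<Rightarrow> 'a \<Rightarrow> 'a) \<Rightarrow> ('a \<Rightarrow> ennreal) \<Rightarrow> bool" where
  "entropy_driven_hemigroup G circ ent \<longleftrightarrow>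
     G \<in> sets borel \<and>
     (\<lambda>(\<xi>, \<nu>). circ \<xi> \<nu>) \<in> restrict_space borel (G \<times> UNIV) \<rightarrow>\<^sub>M borel \<and>
     entropy_on G ent \<and>
     (\<forall>\<xi>\<in>G. \<forall>\<nu>. ent (circ \<xi> \<nu>) = ent \<xi> + ent \<nu>)"

definition deterministic_systems ::
  "'a set \<Rightarrow> ('a \<Rightarrow> 'a \<Rightarrow> 'a) \<Rightarrow> ('a \<Rightarrow> ennreal) \<Rightarrow> 'a set \<Rightarrow> bool" where
  "deterministic_systems G dplus ent Gs \<longleftrightarrow>
     Gs \<noteq> {} \<and> Gs \<subseteq> zero_set G ent \<and>
     (\<forall>\<xi>\<in>G. \<forall>\<eta>\<in>Gs. ent (dplus \<xi> \<eta>) = ent \<xi> \<and> ent (dplus \<eta> \<xi>) = ent \<xi>)"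

definition comparison_sign ::
  "'a set \<Rightarrow> ('a \<Rightarrow> 'a \<Rightarrow> 'a) \<Rightarrow> ('a \<Rightarrow> ennreal) \<Rightarrow> real \<Rightarrow> bool" where
  "comparison_sign G dplus ent s \<longleftrightarrow>
     s \<in> {-1, 1} \<and>
     (\<forall>\<xi>\<in>G. s * (enn2real (ent (dplus \<xi> \<xi>)) - 2 * enn2real (ent \<xi>)) \<ge> 0)"

definition comparable_elements ::
  "'a::topological_space set \<Rightarrow> ('a \<Rightarrow> 'a \<Rightarrow> 'a) \<Rightarrow> ('a \<Rightarrow> 'a \<Rightarrow> 'a) \<Rightarrow> ('a \<Rightarrow> ennreal) \<Rightarrow> bool" where
  "comparable_elements G circ dplus ent \<longleftrightarrow>
     entropy_driven_hemigroup G circ ent \<and>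
     (\<forall>\<xi>\<in>G. ent \<xi> < \<infinity>) \<and>
     (\<forall>\<xi>\<in>G. \<forall>\<eta>\<in>G. dplus \<xi> \<eta> \<in> G) \<and>
     (\<exists>Gs. deterministic_systems G dplus ent Gs) \<and>
     (\<exists>s. comparison_sign G dplus ent s)"

definition rho ::
  "('a \<Rightarrow> 'a \<Rightarrow> 'a) \<Rightarrow> ('a \<Rightarrow> 'a \<Rightarrow> 'a) \<Rightarrow> ('a \<Rightarrow> ennreal) \<Rightarrow> real \<Rightarrow> 'a \<Rightarrow> 'a \<Rightarrow> real" where
  "rho circ dplus ent a \<xi> \<nu> =
     a * enn2real (ent (dplus \<xi> \<nu>)) + (1 - a) * enn2real (ent (circ \<xi> \<nu>))"

definition Xi ::
  "'a set \<Rightarrow> ('a \<Rightarrow> 'a \<Rightarrow> 'a) \<Rightarrow> ('a \<Rightarrow> 'a \<Rightarrow> 'a) \<Rightarrow> ('a \<Rightarrow> ennreal) \<Rightarrow> real set" where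
  "Xi G circ dplus ent = {a. \<forall>\<xi>\<in>G. \<forall>\<nu>\<in>G. rho circ dplus ent a \<xi> \<nu> \<ge> 0}"

text \<open>
  \<open>Xi\<close> may be unbounded, so its supremum and infimum are extended reals.  Division in
  \<^typ>\<open>ereal\<close> satisfies \<open>x / \<infinity> = x / (- \<infinity>) = 0\<close> for finite \<open>x\<close>.
\<close>

definition sup_Xi ::
  "'a set \<Rightarrow> ('a \<Rightarrow> 'a \<Rightarrow> 'a) \<Rightarrow> ('a \<Rightarrow> 'a \<Rightarrow> 'a) \<Rightarrow> ('a \<Rightarrow> ennreal) \<Rightarrow> ereal" where
  "sup_Xi G circ dplus ent = (SUP a\<in>Xi G circ dplus ent. ereal a)"

definition inf_Xi ::
  "'a set \<Rightarrow> ('a \<Rightarrow> 'a \<Rightarrow> 'a) \<Rightarrow> ('a \<Rightarrow> 'a \<Rightarrow> 'a) \<Rightarrow> ('a \<Rightarrow> ennreal) \<Rightarrow> ereal" where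
  "inf_Xi G circ dplus ent = (INF a\<in>Xi G circ dplus ent. ereal a)"

definition hsp_assoc ::
  "('a \<Rightarrow> 'a \<Rightarrow> 'a) \<Rightarrow> ('a \<Rightarrow> 'a \<Rightarrow> 'a) \<Rightarrow> ('a \<Rightarrow> ennreal) \<Rightarrow> real \<Rightarrow> 'a \<Rightarrow> 'a \<Rightarrow> real" where
  "hsp_assoc circ dplus ent s \<xi> \<eta> =
     s * (enn2real (ent (dplus \<xi> \<eta>)) - enn2real (ent (circ \<xi> \<eta>)))"

definition entropy_ratios ::
  "'a set \<Rightarrow> ('a \<Rightarrow> 'a \<Rightarrow> 'a) \<Rightarrow> ('a \<Rightarrow> 'a \<Rightarrow> 'a) \<Rightarrow> ('a \<Rightarrow> ennreal) \<Rightarrow> ereal set" where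
  "entropy_ratios G circ dplus ent =
     {ereal (enn2real (ent (dplus \<xi> \<nu>)) / enn2real (ent (circ \<xi> \<nu>))) | \<xi> \<nu>.
        \<xi> \<in> G \<and> \<nu> \<in> G \<and> ent (circ \<xi> \<nu>) > 0}"

definition M_G ::
  "'a set \<Rightarrow> ('a \<Rightarrow> 'a \<Rightarrow> 'a) \<Rightarrow> ('a \<Rightarrow> 'a \<Rightarrow> 'a) \<Rightarrow> ('a \<Rightarrow> ennreal) \<Rightarrow> ereal" where
  "M_G G circ dplus ent = Sup (entropy_ratios G circ dplus ent)"

definition m_G ::
  "'a set \<Rightarrow> ('a \<Rightarrow> 'a \<Rightarrow> 'a) \<Rightarrow> ('a \<Rightarrow> 'a \<Rightarrow> 'a) \<Rightarrow> ('a \<Rightarrow> ennreal) \<Rightarrow> ereal" where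
  "m_G G circ dplus ent = Inf (entropy_ratios G circ dplus ent)"

text \<open>
  In \<^typ>\<open>ereal\<close>, \<open>1 / 0 = \<infinity>\<close>: the value below is infinite exactly if the relevant extremal
  ratio equals 1.  It is \<open>0\<close> if \<open>s = 1\<close> and the supremum of the ratios is \<open>\<infinity>\<close>.
\<close>

definition a_sel ::
  "'a set \<Rightarrow> ('a \<Rightarrow> 'a \<Rightarrow> 'a) \<Rightarrow> ('a \<Rightarrow> 'a \<Rightarrow> 'a) \<Rightarrow> ('a \<Rightarrow> ennreal) \<Rightarrow> real \<Rightarrow> ereal" where
  "a_sel G circ dplus ent s =
     (if s = -1 then 1 / (1 - m_G G circ dplus ent) else 1 / (1 - M_G G circ dplus ent))"

text \<open>The canonical products are meaningful only if \<open>\<bar>a_sel G circ dplus ent s\<bar> \<noteq> \<infinity>\<close>.\<close>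

definition hsp ::
  "'a set \<Rightarrow> ('a \<Rightarrow> 'a \<Rightarrow> 'a) \<Rightarrow> ('a \<Rightarrow> 'a \<Rightarrow> 'a) \<Rightarrow> ('a \<Rightarrow> ennreal) \<Rightarrow> real \<Rightarrow> 'a \<Rightarrow> 'a \<Rightarrow> real" where
  "hsp G circ dplus ent s \<xi> \<eta> =
     \<bar>real_of_ereal (a_sel G circ dplus ent s)\<bar> * hsp_assoc circ dplus ent s \<xi> \<eta>"

definition hsp2 ::
  "'a set \<Rightarrow> ('a \<Rightarrow> 'a \<Rightarrow> 'a) \<Rightarrow> ('a \<Rightarrow> 'a \<Rightarrow> 'a) \<Rightarrow> ('a \<Rightarrow> ennreal) \<Rightarrow> real \<Rightarrow> 'a \<Rightarrow> 'a \<Rightarrow> real" where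
  "hsp2 G circ dplus ent s \<xi> \<eta> = hsp G circ dplus ent s \<xi> \<eta> / 2"

end

theory Submission
  imports Defs
begin

text \<open>
  Write \<open>C\<close> for the entropy of \<open>circ \<xi> \<eta>\<close> and \<open>x\<close> for the entropy of \<open>dplus \<xi> \<eta>\<close> minus \<open>C\<close>.  Then
  \<open>\<rho>\<^sub>a(\<xi>, \<eta>) = C + a * x\<close>, so every \<open>a \<in> \<Xi>\<close> satisfies the affine constraint \<open>C + a * x \<ge> 0\<close>, which
  passes to finite values of \<open>sup \<Xi>\<close> and \<open>inf \<Xi>\<close> and forces a sign of \<open>x\<close> if one of these is infinite.
  The four bounds are rearrangements of the constraint.  The remaining claims follow from
  additivity of the entropy along \<open>circ\<close>.
\<close>

text \<open>For \<open>x < 0\<close> the constraint says \<open>a \<le> C / (- x)\<close>, a bound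
  that the supremum inherits; hence an infinite supremum excludes \<open>x < 0\<close>. For
  \<open>x \<ge> 0\<close> the left side grows with \<open>a\<close>, so validity at the witness
  \<open>b\<close> suffices.\<close>

lemma SUP_affine_nonneg:
  fixes A :: "real set" and C x :: real
  assumes A: "\<And>a. a \<in> A \<Longrightarrow> 0 \<le> C + a * x" and b: "b \<in> A" "0 \<le> b"
  obtains r where "(SUP a\<in>A. ereal a) = ereal r" "b \<le> r" "0 \<le> C + r * x"
    | "(SUP a\<in>A. ereal a) = \<infinity>" "0 \<le> x"
proof -
  let ?S = "SUP a\<in>A. ereal a"
  have bS: "ereal b \<le> ?S" using b(1) by (rule SUP_upper)
  have bound: "?S \<le> ereal (C / (- x))" if "x < 0"
  proof (rule SUP_least)
    fix a assume "a \<in> A"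
    then show "ereal a \<le> ereal (C / (- x))" using A[of a] that by (simp add: field_simps)
  qed
  show thesis
  proof (cases ?S)
    case (real r)
    have br: "b \<le> r" using bS real by simp
    have "0 \<le> C + r * x"
    proof (cases "x < 0")
      case True
      then show ?thesis using bound real by (simp add: field_simps)
    next
      case False
      then have "b * x \<le> r * x" using br by (intro mult_right_mono) auto
      then show ?thesis using A[OF b(1)] by linarith
    qed
    then show thesis using that(1) real br by blast
  next
    case PInf
    then show thesis using that(2) bound by force
  next
    case MInf
    then show thesis using bS by simp
  qed
qed

text \<open>Mirror image of the previous lemma under \<open>a \<mapsto> - a\<close>,
  \<open>x \<mapsto> - x\<close>, which keeps the products \<open>a * x\<close>.\<close>

lemma INF_affine_nonneg:
  fixes A :: "real set" and C x :: real
  assumes A: "\<And>a. a \<in> A \<Longrightarrow> 0 \<le> C + a * x" and b: "b \<in> A" "b \<le> 0"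
  obtains r where "(INF a\<in>A. ereal a) = ereal r" "r \<le> b" "0 \<le> C + r * x"
    | "(INF a\<in>A. ereal a) = - \<infinity>" "x \<le> 0"
proof -
  have "(SUP a\<in>uminus ` A. ereal a) = - (INF a\<in>A. ereal a)"
    by (simp add: image_image ereal_INF_uminus_eq flip: uminus_ereal.simps ereal_SUP_uminus_eq)
  then have eq: "(INF a\<in>A. ereal a) = - (SUP a\<in>uminus ` A. ereal a)" by simp
  show thesis
  proof (rule SUP_affine_nonneg[of "uminus ` A" C "- x" "- b"])
    show "0 \<le> C + a * - x" if "a \<in> uminus ` A" for a
      using A[of "- a"] that by auto
  next
    fix r assume "(SUP a\<in>uminus ` A. ereal a) = ereal r" "- b \<le> r" "0 \<le> C + r * - x"
    then show thesis using that(1)[of "- r"] eq by simp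
  qed (use b that(2) eq in auto)
qed

theorem proposition3p19:
  fixes G Gs :: "'a::topological_space set"
    and circ dplus :: "'a \<Rightarrow> 'a \<Rightarrow> 'a"
    and ent :: "'a \<Rightarrow> ennreal"
    and s a :: real
    and star :: "'a \<Rightarrow> 'a \<Rightarrow> real"
    and \<xi> \<eta> \<nu> \<epsilon> :: 'a
  assumes "comparable_elements G circ dplus ent"
    and "deterministic_systems G dplus ent Gs"
    and "comparison_sign G dplus ent s"
    and "a \<in> Xi G circ dplus ent - {0}"
    and "star = hsp_assoc circ dplus ent s \<or>
         \<bar>a_sel G circ dplus ent s\<bar> \<noteq> \<infinity> \<and>
           (star = hsp G circ dplus ent s \<or> star = hsp2 G circ dplus ent s)"
    and "\<xi> \<in> G" and "\<eta> \<in> G" and "\<nu> \<in> G" and "\<epsilon> \<in> Gs"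
  shows
    "(star = hsp_assoc circ dplus ent s \<or> a_sel G circ dplus ent s \<noteq> 0 \<longrightarrow>
        (star \<xi> \<eta> = star \<eta> \<xi> \<longleftrightarrow> ent (dplus \<xi> \<eta>) = ent (dplus \<eta> \<xi>))) \<and>
     star \<xi> \<xi> \<ge> 0 \<and>
     (dplus (dplus \<xi> \<eta>) \<nu> = dplus \<xi> (dplus \<eta> \<nu>) \<longrightarrow>
        star (dplus \<xi> \<eta>) \<nu> = star \<xi> (dplus \<eta> \<nu>) - star \<xi> \<eta> + star \<eta> \<nu>) \<and>
     star \<xi> \<epsilon> = 0 \<and>
     ereal (s * hsp_assoc circ dplus ent s \<xi> \<eta>)
       \<ge> - (ereal (enn2real (ent (circ \<xi> \<eta>))) / sup_Xi G circ dplus ent) \<and>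
     (inf_Xi G circ dplus ent \<noteq> 0 \<longrightarrow>
        ereal (s * hsp_assoc circ dplus ent s \<xi> \<eta>)
          \<le> - (ereal (enn2real (ent (circ \<xi> \<eta>))) / inf_Xi G circ dplus ent)) \<and>
     (sup_Xi G circ dplus ent \<noteq> 1 \<longrightarrow>
        ereal (s * hsp_assoc circ dplus ent s \<xi> \<eta>)
          \<ge> ereal (enn2real (ent (dplus \<xi> \<eta>))) / (1 - sup_Xi G circ dplus ent)) \<and>
     ereal (s * hsp_assoc circ dplus ent s \<xi> \<eta>)
       \<le> ereal (enn2real (ent (dplus \<xi> \<eta>))) / (1 - inf_Xi G circ dplus ent) \<and>
     (rho circ dplus ent a \<xi> \<eta> = rho circ dplus ent a \<eta> \<xi> \<longleftrightarrow>
        ent (dplus \<xi> \<eta>) = ent (dplus \<eta> \<xi>)) \<and>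
     rho circ dplus ent a \<xi> \<epsilon> = enn2real (ent \<xi>)"
proof -
  let ?e = "\<lambda>\<xi>. enn2real (ent \<xi>)"
  let ?D = "?e (dplus \<xi> \<eta>)" and ?C = "?e (circ \<xi> \<eta>)"
  let ?X = "Xi G circ dplus ent"
  note in_G = \<open>\<xi> \<in> G\<close> \<open>\<eta> \<in> G\<close> \<open>\<nu> \<in> G\<close>
  have closed: "dplus x y \<in> G" and fin: "ent x < \<infinity>"
    and circ: "ent (circ x y) = ent x + ent y" if "x \<in> G" "y \<in> G" for x y
    using assms(1) that unfolding comparable_elements_def entropy_driven_hemigroup_def by auto
  \<comment> \<open>\<open>enn2real\<close> sends infinity to 0, so both its additivity here and its
    injectivity in \<open>eq_iff\<close> rest on finiteness of the entropy on
    \<open>G\<close>.\<close>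
  have circ_real: "?e (circ x y) = ?e x + ?e y" if "x \<in> G" "y \<in> G" for x y
    using circ[OF that] fin[of x x] fin[of y y] that by (simp add: enn2real_plus)
  have eq_iff: "?e x = ?e y \<longleftrightarrow> ent x = ent y" if "x \<in> G" "y \<in> G" for x y
    using fin[of x x] fin[of y y] that by (metis ennreal_enn2real infinity_ennreal_def)
  have s: "s \<noteq> 0" "s * s = 1"
    and diag: "s * (?e (dplus \<xi> \<xi>) - 2 * ?e \<xi>) \<ge> 0"
    using assms(3) in_G unfolding comparison_sign_def by auto
  have eps: "\<epsilon> \<in> G" "ent \<epsilon> = 0" "ent (dplus \<xi> \<epsilon>) = ent \<xi>"
    using assms(2,9) in_G unfolding deterministic_systems_def zero_set_def by auto
  have assoc: "hsp_assoc circ dplus ent s x y = s * (?e (dplus x y) - ?e x - ?e y)"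
    if "x \<in> G" "y \<in> G" for x y
    using circ_real[OF that] by (simp add: hsp_assoc_def)

  \<comment> \<open>All choices of \<open>star\<close> are multiples of the associated product, with
    factor 1, \<open>\<bar>a_sel\<bar>\<close> or half of it. The last two vanish if
    \<open>s = 1\<close> and the entropy ratios are unbounded; \<open>star\<close> is then
    identically 0, hence the guard on the symmetry claim.\<close>
  obtain k where k: "k \<ge> 0" "star = (\<lambda>x y. k * hsp_assoc circ dplus ent s x y)"
    and k_pos: "star = hsp_assoc circ dplus ent s \<or> a_sel G circ dplus ent s \<noteq> 0 \<Longrightarrow> k \<noteq> 0"
  proof (cases "star = hsp_assoc circ dplus ent s")
    case True
    then show thesis using that[of 1] by auto
  next
    case False
    then have a: "\<bar>a_sel G circ dplus ent s\<bar> \<noteq> \<infinity>"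
      and star: "star = hsp G circ dplus ent s \<or> star = hsp2 G circ dplus ent s"
      using assms(5) by auto
    define r where "r = \<bar>real_of_ereal (a_sel G circ dplus ent s)\<bar>"
    have r_nonneg: "r \<ge> 0" unfolding r_def by (rule abs_ge_zero)
    have "r \<noteq> 0" if "a_sel G circ dplus ent s \<noteq> 0"
      using a that unfolding r_def by (cases "a_sel G circ dplus ent s") auto
    then have r: "star = hsp_assoc circ dplus ent s \<or> a_sel G circ dplus ent s \<noteq> 0 \<Longrightarrow> r \<noteq> 0"
      using False by blast
    from star show thesis
    proof
      assume "star = hsp G circ dplus ent s"
      then show thesis using r r_nonneg
        by (intro that[of r]) (simp_all add: hsp_def fun_eq_iff flip: r_def del: abs_real_of_ereal)
    next
      assume "star = hsp2 G circ dplus ent s"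
      then show thesis using r r_nonneg
        by (intro that[of "r / 2"]) (simp_all add: hsp2_def hsp_def fun_eq_iff flip: r_def del: abs_real_of_ereal)
    qed
  qed
  have star_eq: "star x y = k * (s * (?e (dplus x y) - ?e x - ?e y))" if "x \<in> G" "y \<in> G" for x y
    using assoc[OF that] k(2) by simp

  have c1: "star \<xi> \<eta> = star \<eta> \<xi> \<longleftrightarrow> ent (dplus \<xi> \<eta>) = ent (dplus \<eta> \<xi>)" if "k \<noteq> 0"
    using eq_iff[of "dplus \<xi> \<eta>" "dplus \<eta> \<xi>"] that s in_G by (auto simp: star_eq closed)
  have c2: "star \<xi> \<xi> \<ge> 0" using k(1) diag in_G by (simp add: star_eq)
  \<comment> \<open>By \<open>star_eq\<close>, \<open>star\<close> is a constant times the
    coboundary of the entropy, so this is the cocycle identity. It needs the two triple sums to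
    agree, and associativity of \<open>dplus\<close> is not an axiom.\<close>
  have c3: "star (dplus \<xi> \<eta>) \<nu> = star \<xi> (dplus \<eta> \<nu>) - star \<xi> \<eta> + star \<eta> \<nu>"
    if "dplus (dplus \<xi> \<eta>) \<nu> = dplus \<xi> (dplus \<eta> \<nu>)"
    using in_G that by (simp add: star_eq closed algebra_simps)
  have c4: "star \<xi> \<epsilon> = 0" using in_G eps by (simp add: star_eq)
  \<comment> \<open>The \<open>circ\<close> terms are symmetric, so the two sides differ by
    \<open>a\<close> times the difference of the \<open>dplus\<close> terms, and \<open>a\<close> is
    nonzero.\<close>
  have c9: "rho circ dplus ent a \<xi> \<eta> = rho circ dplus ent a \<eta> \<xi> \<longleftrightarrow>
      ent (dplus \<xi> \<eta>) = ent (dplus \<eta> \<xi>)"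
    using eq_iff[of "dplus \<xi> \<eta>" "dplus \<eta> \<xi>"] assms(4) in_G
    by (simp add: rho_def circ_real closed add.commute)
  have c10: "rho circ dplus ent a \<xi> \<epsilon> = ?e \<xi>"
    using in_G eps by (simp add: rho_def circ_real algebra_simps)

  have x: "s * hsp_assoc circ dplus ent s \<xi> \<eta> = ?D - ?C"
    using s(2) by (simp add: hsp_assoc_def flip: mult.assoc)
  have X: "0 \<le> ?C + a * (?D - ?C)" if "a \<in> ?X" for a
    using that in_G by (auto simp: Xi_def rho_def algebra_simps)
  \<comment> \<open>These witnesses give \<open>sup \<ge> 1\<close> and \<open>inf \<le> 0\<close>,
    which fixes the signs of all denominators below.\<close>
  have X01: "0 \<in> ?X" "1 \<in> ?X" by (auto simp: Xi_def rho_def)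
  have upper: "- (ereal ?C / sup_Xi G circ dplus ent) \<le> ereal (?D - ?C) \<and>
      (sup_Xi G circ dplus ent \<noteq> 1 \<longrightarrow>
        ereal ?D / (1 - sup_Xi G circ dplus ent) \<le> ereal (?D - ?C))"
  proof (rule SUP_affine_nonneg[OF X X01(2)])
    fix r assume "(SUP a\<in>?X. ereal a) = ereal r" and r: "1 \<le> r" "0 \<le> ?C + r * (?D - ?C)"
    then have S: "sup_Xi G circ dplus ent = ereal r" by (simp add: sup_Xi_def)
    have "- (?C / r) \<le> ?D - ?C" using r by (simp add: field_simps)
    \<comment> \<open>The constraint rewrites as \<open>(1 - r) * (?D - ?C) \<le> ?D\<close>;
      dividing by the negative \<open>1 - r\<close> reverses it.\<close>
    moreover have "?D / (1 - r) \<le> ?D - ?C" if "r \<noteq> 1"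
    proof -
      have "1 - r < 0" using r that by simp
      then show ?thesis using r by (simp add: neg_divide_le_eq) (simp add: algebra_simps)
    qed
    ultimately show ?thesis using S r by (auto simp: one_ereal_def)
  \<comment> \<open>If the supremum is infinite, both quotients are 0 in \<open>ereal\<close> and
    the sign of \<open>?D - ?C\<close> is all that is claimed.\<close>
  qed (auto simp: sup_Xi_def one_ereal_def)
  have lower: "(inf_Xi G circ dplus ent \<noteq> 0 \<longrightarrow>
        ereal (?D - ?C) \<le> - (ereal ?C / inf_Xi G circ dplus ent)) \<and>
      ereal (?D - ?C) \<le> ereal ?D / (1 - inf_Xi G circ dplus ent)"
  proof (rule INF_affine_nonneg[OF X X01(1)])
    fix r assume "(INF a\<in>?X. ereal a) = ereal r" and r: "r \<le> 0" "0 \<le> ?C + r * (?D - ?C)"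
    then have I: "inf_Xi G circ dplus ent = ereal r" by (simp add: inf_Xi_def)
    have "?D - ?C \<le> - (?C / r)" if "r \<noteq> 0"
    proof -
      have "r < 0" using r that by simp
      then have "?D - ?C \<le> (- ?C) / r"
        unfolding neg_le_divide_eq[OF \<open>r < 0\<close>] using r by (simp add: algebra_simps)
      then show ?thesis by simp
    qed
    moreover have "?D - ?C \<le> ?D / (1 - r)"
      using r by (simp add: pos_le_divide_eq) (simp add: algebra_simps)
    ultimately show ?thesis using I r by (auto simp: one_ereal_def)
  qed (auto simp: inf_Xi_def one_ereal_def)
  show ?thesis
    unfolding x using c1 k_pos c2 c3 c4 c9 c10 upper lower by blast
qed

end
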